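(* There exists $n_0$ such that for all $n>n_0$, the interval $[n]$ is the unique subset $A\subseteq[n]$ with $g(A,3)=g(n,3)$; that is, $g(A,3)<g([n],3)$ for every $A\subsetneq [n]$.
   Context: $[n]=\{1,\dots,n\}$. An $r$-coloring of $A$ is a map $A\to[r]$. A rainbow sum is a triple of three distinct elements $x,y,z$ with $x+y=z$ colored with three different colors; a coloring is rainbow sum-free if it has no rainbow sum. $g(A,r)$ is the number of rainbow sum-free $r$-colorings of $A$, and $g(n,r)=\max_{A\subseteq[n]} g(A,r)$. *)

theory Defs
  imports Complex_Main "HOL-Library.FuncSet"
begin

(* Colorings are extensional functions (undefined outside A), so that each map A \<rightarrow> [r]
   is represented, and hence counted, exactly once. *)
definition colorings :: "nat set \<Rightarrow> nat \<Rightarrow> (nat \<Rightarrow> nat) set" where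
  "colorings A r = A \<rightarrow>\<^sub>E {1..r}"

definition rainbow_sum :: "nat set \<Rightarrow> (nat \<Rightarrow> nat) \<Rightarrow> nat \<Rightarrow> nat \<Rightarrow> nat \<Rightarrow> bool" where
  "rainbow_sum A c x y z \<longleftrightarrow>
     x \<in> A \<and> y \<in> A \<and> z \<in> A \<and>
     x \<noteq> y \<and> x \<noteq> z \<and> y \<noteq> z \<and>
     x + y = z \<and>
     c x \<noteq> c y \<and> c x \<noteq> c z \<and> c y \<noteq> c z"

definition rainbow_sum_free :: "nat set \<Rightarrow> (nat \<Rightarrow> nat) \<Rightarrow> bool" where
  "rainbow_sum_free A c \<longleftrightarrow> \<not> (\<exists>x y z. rainbow_sum A c x y z)"

definition g :: "nat set \<Rightarrow> nat \<Rightarrow> nat" where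
  "g A r = card {c \<in> colorings A r. rainbow_sum_free A c}"

definition g_max :: "nat \<Rightarrow> nat \<Rightarrow> nat" where
  "g_max n r = Max ((\<lambda>A. g A r) ` Pow {1..n})"

end

(* Colour the elements of A in increasing order. Given the colours below v, the allowed colours at v
   are all three only if every pair x + y = v inside A is monochromatic; this leaves at most about
   3^(v/2) colourings below v, so beyond a constant every step has at most two options, up to
   an arbitrarily small multiple of 2^n. The colourings with two colours number 3 * 2^|A| - 3, so it
   suffices that only o(2^n) rainbow sum-free colourings, uniformly in A, use all three colours.
   A three-coloured colouring that still has two options at n loses almost nothing only if almost all
   steps before n have two options; the pairs x + y = n then force the colour forbidden at n to occur
   a bounded number of times. But one occurrence z of such a rare colour forces
   c x = c (x + z) and c x = c (z - x) for almost all x, leaving about 2^(n/2) colourings. *)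

theory Submission
  imports Defs "HOL-Real_Asymp.Real_Asymp"
begin

section \<open>Trees of partial colourings and the weight of their leaves\<close>

definition trunc :: "nat \<Rightarrow> (nat \<Rightarrow> nat) \<Rightarrow> nat \<Rightarrow> nat" where
  "trunc m c = (\<lambda>x. if x \<le> m then c x else 0)"

lemma trunc_trunc: "trunc s (trunc m c) = trunc (min s m) c"
  by (auto simp: trunc_def)

text \<open>Kraft's inequality for the tree of partial colourings: when every node has at most two children,
  a leaf reached through \<open>t\<close> nodes with a single child accounts for \<open>2 ^ t\<close> of the \<open>2 ^ (n - s)\<close>
  leaves of the full binary tree.\<close>

lemma branching_sum:
  fixes Opt :: "(nat \<Rightarrow> nat) \<Rightarrow> nat \<Rightarrow> nat set"
  assumes "finite G" and "\<And>c x. c \<in> G \<Longrightarrow> x > n \<Longrightarrow> c x = 0" and "s \<le> n"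
    and "\<And>c v. c \<in> G \<Longrightarrow> s < v \<Longrightarrow> v \<le> n \<Longrightarrow>
      c v \<in> Opt (trunc (v - 1) c) v \<and> finite (Opt (trunc (v - 1) c) v) \<and>
      card (Opt (trunc (v - 1) c) v) \<le> 2"
  shows "(\<Sum>c\<in>G. 2 ^ card {v \<in> {s<..n}. card (Opt (trunc (v - 1) c) v) \<le> 1})
    \<le> card (trunc s ` G) * (2::nat) ^ (n - s)"
  using assms
\<comment> \<open>The last level is peeled off: members of \<open>G\<close> are grouped by their
  truncation to \<open>m = n - 1\<close>, and the induction hypothesis is applied to the set of
  these truncations.\<close>
proof (induction "n - s" arbitrary: n G)
  case 0
  then have n: "n = s" by simp
  have "trunc s c = c" if "c \<in> G" for c
    using "0.prems"(2)[OF that] n by (fastforce simp: trunc_def)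
  then have "trunc s ` G = G" by simp
  then show ?case using n by simp
next
  case (Suc k)
  then obtain m where n: "n = Suc m" and m: "s \<le> m"
    by (cases n) auto
  define T where "T = (\<lambda>m c. card {v \<in> {s<..m}. card (Opt (trunc (v - 1) c) v) \<le> 1})"
  let ?G' = "trunc m ` G"
  have fin: "finite G" by fact
  have tt: "trunc (v - 1) (trunc m c) = trunc (v - 1) c" if "v \<le> Suc m" for v c
  proof -
    have "v - 1 \<le> m" using that by simp
    then show ?thesis by (simp only: trunc_trunc min_absorb1)
  qed
  have IH: "(\<Sum>d\<in>?G'. 2 ^ T m d) \<le> card (trunc s ` ?G') * (2::nat) ^ (m - s)"
    unfolding T_def
  proof (rule Suc.hyps(1))
    show "k = m - s" using Suc.hyps(2) n by simp
    show "finite ?G'" using fin by simp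
    show "c x = 0" if "c \<in> ?G'" "x > m" for c x using that by (auto simp: trunc_def)
    show "s \<le> m" by fact
    fix c v assume c: "c \<in> ?G'" and v: "s < v" "v \<le> m"
    then obtain d where d: "d \<in> G" "c = trunc m d" by auto
    have "c v = d v" using v d by (simp add: trunc_def)
    then show "c v \<in> Opt (trunc (v - 1) c) v \<and> finite (Opt (trunc (v - 1) c) v) \<and>
      card (Opt (trunc (v - 1) c) v) \<le> 2"
      using Suc.prems(4)[OF d(1) v(1)] v tt[of v d] d n by simp
  qed
  have img: "trunc s ` ?G' = trunc s ` G"
    using m by (simp add: image_image trunc_trunc min_def)
  \<comment> \<open>If \<open>d\<close> has one option, there is at most one child and its weight
    doubles; if it has two, there are at most two children of unchanged weight. Either way the total
    at most doubles.\<close>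
  have fiber: "(\<Sum>c\<in>{c\<in>G. trunc m c = d}. (2::nat) ^ T n c) \<le> 2 * 2 ^ T m d" if d: "d \<in> ?G'" for d
  proof -
    let ?F = "{c\<in>G. trunc m c = d}"
    let ?O = "Opt d n"
    have O: "c n \<in> ?O \<and> finite ?O \<and> card ?O \<le> 2" if "c \<in> ?F" for c
      using Suc.prems(4)[of c n] that m n by auto
    obtain c0 where c0: "c0 \<in> ?F" using d by auto
    have finO: "finite ?O" and O2: "card ?O \<le> 2" using O[OF c0] by auto
    have inj: "inj_on (\<lambda>c. c n) ?F"
    proof (rule inj_onI, rule ext)
      fix a b x assume a: "a \<in> ?F" and b: "b \<in> ?F" and e: "a n = b n"
      have "trunc m a x = trunc m b x" using a b by simp
      moreover have "a x = 0" "b x = 0" if "x > n" using Suc.prems(2) a b that by auto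
      ultimately show "a x = b x" using e n by (cases "x \<le> m"; cases "x = n") (auto simp: trunc_def)
    qed
    have cF: "card ?F \<le> card ?O"
      using O by (intro card_inj_on_le[OF inj _ finO]) auto
    have Tn: "T n c = T m d + (if card ?O \<le> 1 then 1 else 0)" if c: "c \<in> ?F" for c
    proof -
      have e: "trunc (v - 1) c = trunc (v - 1) d" if "v \<le> Suc m" for v
        using tt[OF that, of c] c by simp
      have "{v \<in> {s<..n}. card (Opt (trunc (v - 1) c) v) \<le> 1} =
        {v \<in> {s<..m}. card (Opt (trunc (v - 1) d) v) \<le> 1} \<union> (if card ?O \<le> 1 then {n} else {})"
      proof (rule set_eqI)
        fix v
        show "v \<in> {v \<in> {s<..n}. card (Opt (trunc (v - 1) c) v) \<le> 1} \<longleftrightarrow>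
          v \<in> {v \<in> {s<..m}. card (Opt (trunc (v - 1) d) v) \<le> 1} \<union> (if card ?O \<le> 1 then {n} else {})"
        proof (cases "v = n")
          case True
          then show ?thesis using m n c by simp
        next
          case False
          then show ?thesis using e[of v] n by (cases "v \<le> m") auto
        qed
      qed
      then show ?thesis unfolding T_def using n by (simp add: card_insert_if)
    qed
    have "(\<Sum>c\<in>?F. (2::nat) ^ T n c) = card ?F * 2 ^ (T m d + (if card ?O \<le> 1 then 1 else 0))"
      using Tn by simp
    also have "\<dots> \<le> 2 * 2 ^ T m d"
      using cF O2 by (cases "card ?O \<le> 1") auto
    finally show ?thesis .
  qed
  have "(\<Sum>c\<in>G. (2::nat) ^ T n c) = (\<Sum>d\<in>?G'. \<Sum>c\<in>{c\<in>G. trunc m c = d}. 2 ^ T n c)"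
    using fin by (intro sum.group[symmetric]) auto
  also have "\<dots> \<le> (\<Sum>d\<in>?G'. 2 * 2 ^ T m d)"
    by (intro sum_mono fiber)
  also have "\<dots> = 2 * (\<Sum>d\<in>?G'. 2 ^ T m d)" by (simp add: sum_distrib_left)
  also have "\<dots> \<le> 2 * (card (trunc s ` G) * (2::nat) ^ (m - s))" using IH img by simp
  also have "\<dots> = card (trunc s ` G) * 2 ^ (n - s)" using n m by (simp add: Suc_diff_le)
  finally show ?case unfolding T_def .
qed

text \<open>Markov's inequality for the sum in \<open>branching_sum\<close>: a branch with at least
  \<open>t\<close> single-option nodes has weight at least \<open>2 ^ t\<close>. By
  \<open>hist\<close> the options consult earlier values only, so the full colouring can replace its
  truncations.\<close>

lemma branching_count:
  fixes Opt :: "(nat \<Rightarrow> nat) \<Rightarrow> nat \<Rightarrow> nat set"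
  assumes "finite G" and "\<And>c x. c \<in> G \<Longrightarrow> x > n \<Longrightarrow> c x = 0" and "s \<le> n"
    and hist: "\<And>c v. c \<in> G \<Longrightarrow> s < v \<Longrightarrow> v \<le> n \<Longrightarrow> Opt (trunc (v - 1) c) v = Opt c v"
    and opt: "\<And>c v. c \<in> G \<Longrightarrow> s < v \<Longrightarrow> v \<le> n \<Longrightarrow>
      c v \<in> Opt c v \<and> finite (Opt c v) \<and> card (Opt c v) \<le> 2"
  shows "card {c \<in> G. t \<le> card {v \<in> {s<..n}. card (Opt c v) \<le> 1}} * 2 ^ t
    \<le> card (trunc s ` G) * (2::nat) ^ (n - s)"
proof -
  let ?H = "{c \<in> G. t \<le> card {v \<in> {s<..n}. card (Opt c v) \<le> 1}}"
  have "card ?H * 2 ^ t = (\<Sum>c\<in>?H. (2::nat) ^ t)" by simp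
  also have "\<dots> \<le> (\<Sum>c\<in>?H. 2 ^ card {v \<in> {s<..n}. card (Opt c v) \<le> 1})"
    by (intro sum_mono power_increasing) auto
  also have "\<dots> \<le> (\<Sum>c\<in>G. 2 ^ card {v \<in> {s<..n}. card (Opt c v) \<le> 1})"
    using assms(1) by (intro sum_mono2) auto
  also have "\<dots> = (\<Sum>c\<in>G. 2 ^ card {v \<in> {s<..n}. card (Opt (trunc (v - 1) c) v) \<le> 1})"
  proof (rule sum.cong[OF refl])
    fix c assume "c \<in> G"
    then have "{v \<in> {s<..n}. card (Opt c v) \<le> 1} = {v \<in> {s<..n}. card (Opt (trunc (v - 1) c) v) \<le> 1}"
      using hist by auto
    then show "(2::nat) ^ card {v \<in> {s<..n}. card (Opt c v) \<le> 1} =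
      2 ^ card {v \<in> {s<..n}. card (Opt (trunc (v - 1) c) v) \<le> 1}" by simp
  qed
  also have "\<dots> \<le> card (trunc s ` G) * (2::nat) ^ (n - s)"
    using assms by (intro branching_sum) auto
  finally show ?thesis .
qed

section \<open>Rainbow sum-free colourings and the colours allowed at an element\<close>

text \<open>Colourings of \<open>A \<inter> {..n}\<close> are extended by the dummy colour \<open>0\<close>. A sum \<open>x + x\<close> or \<open>x + 0\<close> is never
  rainbow, so distinctness of the summands need not be required.\<close>

definition col :: "nat set \<Rightarrow> nat \<Rightarrow> (nat \<Rightarrow> nat) set" where
  "col A n = {c. (\<forall>x. c x \<in> (if x \<in> A \<and> x \<le> n then {1,2,3} else {0})) \<and>
     (\<forall>x y. c x \<noteq> 0 \<longrightarrow> c y \<noteq> 0 \<longrightarrow> c (x + y) \<noteq> 0 \<longrightarrow>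
        c x = c y \<or> c x = c (x + y) \<or> c y = c (x + y))}"

text \<open>The value \<open>{0}\<close> off \<open>A\<close> turns a gap of \<open>A\<close> into a
  node with a single option, so the tree count penalises missing elements as well.\<close>

definition palette :: "nat set \<Rightarrow> (nat \<Rightarrow> nat) \<Rightarrow> nat \<Rightarrow> nat set" where
  "palette A c v = (if v \<in> A then {i \<in> {1,2,3}. \<forall>x y. x + y = v \<longrightarrow> c x \<noteq> 0 \<longrightarrow> c y \<noteq> 0 \<longrightarrow>
      c x = c y \<or> i = c x \<or> i = c y} else {0})"

text \<open>For \<open>m \<in> A\<close> this is the case of a full palette: a single bichromatic
  pair already cuts the palette at \<open>m\<close> down to its own two colours.\<close>

definition pal :: "(nat \<Rightarrow> nat) \<Rightarrow> nat \<Rightarrow> bool" where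
  "pal c m \<longleftrightarrow> (\<forall>x y. x + y = m \<longrightarrow> c x \<noteq> 0 \<longrightarrow> c y \<noteq> 0 \<longrightarrow> c x = c y)"

context
  fixes A :: "nat set"
  assumes zero: "0 \<notin> A"
begin

lemma col_values:
  assumes "c \<in> col A n"
  shows "c x = 0 \<longleftrightarrow> \<not> (x \<in> A \<and> x \<le> n)" and "c x \<in> {0,1,2,3}"
    and "x \<in> A \<Longrightarrow> x \<le> n \<Longrightarrow> c x \<in> {1,2,3}"
proof -
  have *: "c x \<in> (if x \<in> A \<and> x \<le> n then {1,2,3} else {0})"
    using assms by (simp add: col_def)
  show "c x = 0 \<longleftrightarrow> \<not> (x \<in> A \<and> x \<le> n)" "c x \<in> {0,1,2,3}"
    "x \<in> A \<Longrightarrow> x \<le> n \<Longrightarrow> c x \<in> {1,2,3}"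
    using * by (cases "x \<in> A \<and> x \<le> n"; auto)+
qed

lemma col_no_rainbow:
  assumes "c \<in> col A n" "c x \<noteq> 0" "c y \<noteq> 0" "c (x + y) \<noteq> 0"
  shows "c x = c y \<or> c x = c (x + y) \<or> c y = c (x + y)"
  using assms unfolding col_def by blast

lemma finite_col: "finite (col A n)"
proof (rule finite_subset)
  show "col A n \<subseteq> {c. \<forall>x. (x \<in> {..n} \<longrightarrow> c x \<in> {0,1,2,3}) \<and> (x \<notin> {..n} \<longrightarrow> c x = 0)}"
  proof clarify
    fix c x assume "c \<in> col A n"
    then show "(x \<in> {..n} \<longrightarrow> c x \<in> {0,1,2,3}) \<and> (x \<notin> {..n} \<longrightarrow> c x = 0)"
      using col_values(1)[of c n x] col_values(2)[of c n x] by auto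
  qed
  show "finite {c. \<forall>x. (x \<in> {..n} \<longrightarrow> c x \<in> {0,1,2,3::nat}) \<and> (x \<notin> {..n} \<longrightarrow> c x = (0::nat))}"
    by (intro finite_set_of_finite_funs) auto
qed

lemma trunc_col: "c \<in> col A n \<Longrightarrow> m \<le> n \<Longrightarrow> trunc m c \<in> col A m"
  unfolding col_def trunc_def by (auto split: if_splits)

text \<open>Among the pairs with sum \<open>v\<close>, only \<open>0 + v\<close> and
  \<open>v + 0\<close> involve the colour of \<open>v\<close> itself, and the dummy colour at
  \<open>0\<close> discards them. So the palette depends on the past alone, as the tree count
  requires.\<close>

lemma palette_cong:
  assumes "c 0 = 0" and "d 0 = 0" and "\<And>x. x < v \<Longrightarrow> c x = d x"
  shows "palette A c v = palette A d v"
proof -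
  have "(x + y = v \<longrightarrow> c x \<noteq> 0 \<longrightarrow> c y \<noteq> 0 \<longrightarrow> c x = c y \<or> i = c x \<or> i = c y) \<longleftrightarrow>
    (x + y = v \<longrightarrow> d x \<noteq> 0 \<longrightarrow> d y \<noteq> 0 \<longrightarrow> d x = d y \<or> i = d x \<or> i = d y)" for x y i
    using assms by (cases "x = 0"; cases "y = 0") auto
  then show ?thesis unfolding palette_def by simp
qed

lemma palette_trunc:
  assumes "c \<in> col A n" "0 < v"
  shows "palette A (trunc (v - 1) c) v = palette A c v"
  using assms zero col_values(1)[OF assms(1), of 0] by (intro palette_cong) (auto simp: trunc_def)

lemma in_palette:
  assumes c: "c \<in> col A n" and v: "v \<le> n"
  shows "c v \<in> palette A c v"
proof (cases "v \<in> A")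
  case True
  then have "c v \<in> {1,2,3}" "c v \<noteq> 0" using col_values[OF c] v by auto
  moreover have "c x = c y \<or> c v = c x \<or> c v = c y"
    if "x + y = v" "c x \<noteq> 0" "c y \<noteq> 0" for x y
  proof -
    have "c x = c y \<or> c x = c (x + y) \<or> c y = c (x + y)"
      using col_no_rainbow[OF c that(2,3)] that(1) \<open>c v \<noteq> 0\<close> by simp
    then show ?thesis using that(1) by metis
  qed
  ultimately show ?thesis unfolding palette_def using True by auto
next
  case False
  then show ?thesis using col_values(1)[OF c] by (simp add: palette_def)
qed

lemma finite_palette: "finite (palette A c v)"
  by (simp add: palette_def)

lemma card_palette_not_pal:
  assumes c: "c \<in> col A n" and np: "v \<in> A \<Longrightarrow> \<not> pal c v"
  shows "card (palette A c v) \<le> 2"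
proof (cases "v \<in> A")
  case True
  then obtain x y where xy: "x + y = v" "c x \<noteq> 0" "c y \<noteq> 0" "c x \<noteq> c y"
    using np by (auto simp: pal_def)
  then have "palette A c v \<subseteq> {c x, c y}" using True by (auto simp: palette_def)
  then have "card (palette A c v) \<le> card {c x, c y}" by (intro card_mono) auto
  then show ?thesis using xy by simp
qed (simp add: palette_def)

text \<open>The maximum with \<open>1\<close> only normalises pairs lying outside \<open>A\<close>; the value at \<open>0\<close> records \<open>c m\<close>.\<close>

lemma card_pal: "card {c \<in> col A m. pal c m} \<le> 3 ^ (m div 2 + 1)"
proof -
  define h where "h = (\<lambda>c::nat\<Rightarrow>nat. restrict (\<lambda>x. max 1 (max (c x) (c (m - x)))) {..m div 2})"
  have "inj_on h {c \<in> col A m. pal c m}"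
  proof (rule inj_onI)
    fix c d assume "c \<in> {c \<in> col A m. pal c m}" "d \<in> {c \<in> col A m. pal c m}" and hh: "h c = h d"
    then have c: "c \<in> col A m" "pal c m" and d: "d \<in> col A m" "pal d m" by auto
    \<comment> \<open>In \<open>A\<close> the colour of \<open>x\<close> is at least
      \<open>1\<close>, and its partner has colour \<open>0\<close> or the same colour, so the
      symmetric maximum recovers \<open>e x\<close>. Hence the lower half of the maxima determines
      the colouring.\<close>
    have key: "e x = (if x \<in> A then max 1 (max (e x) (e (m - x))) else 0)"
      if e: "e \<in> col A m" "pal e m" "x \<le> m" for e x
    proof (cases "x \<in> A")
      case True
      then have "e x \<in> {1,2,3}" using col_values(3)[OF e(1)] e(3) by blast
      moreover from this have "e x \<noteq> 0" by auto
      moreover have "x + (m - x) = m" using e(3) by simp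
      moreover have "e (m - x) = 0 \<or> e (m - x) = e x"
        using e(2) calculation(2,3) unfolding pal_def by metis
      ultimately show ?thesis using True by auto
    next
      case False
      then show ?thesis using col_values(1)[OF e(1)] by simp
    qed
    have "c x = d x" for x
    proof (cases "x \<le> m")
      case True
      have "max 1 (max (c x) (c (m - x))) = max 1 (max (d x) (d (m - x)))"
      proof (cases "x \<le> m div 2")
        case True
        then show ?thesis using fun_cong[OF hh, of x] by (simp add: h_def)
      next
        case False
        then have "m - x \<le> m div 2" "m - (m - x) = x" using True by auto
        then show ?thesis using fun_cong[OF hh, of "m - x"] by (simp add: h_def max.commute)
      qed
      then show ?thesis by (subst key[OF c True], subst key[OF d True]) simp
    next
      case False
      then show ?thesis using col_values(1)[OF c(1), of x] col_values(1)[OF d(1), of x] by simp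
    qed
    then show "c = d" by auto
  qed
  moreover have "h ` {c \<in> col A m. pal c m} \<subseteq> {..m div 2} \<rightarrow>\<^sub>E {1,2,3}"
  proof clarify
    fix c assume c: "c \<in> col A m"
    have "max 1 (max (c x) (c y)) \<in> {1,2,3}" for x y
      using col_values(2)[OF c, of x] col_values(2)[OF c, of y] by (auto simp: max_def)
    then show "h c \<in> {..m div 2} \<rightarrow>\<^sub>E {1,2,3}" unfolding h_def by auto
  qed
  ultimately have "card {c \<in> col A m. pal c m} \<le> card ({..m div 2} \<rightarrow>\<^sub>E {1,2,3::nat})"
    by (intro card_inj_on_le) (auto intro: finite_PiE)
  then show ?thesis by (simp add: card_PiE numeral_3_eq_3)
qed

text \<open>Four values per position, the dummy included. This crude bound is applied only at a
  level fixed in advance, where it costs a constant factor.\<close>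

lemma card_col: "card (col A n) \<le> 4 ^ (n + 1)"
proof -
  let ?r = "\<lambda>c::nat\<Rightarrow>nat. restrict c {..n}"
  have "inj_on ?r (col A n)"
  proof (rule inj_onI, rule ext)
    fix c d x assume c: "c \<in> col A n" and d: "d \<in> col A n" and e: "?r c = ?r d"
    show "c x = d x"
      using fun_cong[OF e, of x] col_values(1)[OF c, of x] col_values(1)[OF d, of x]
      by (cases "x \<le> n") auto
  qed
  moreover have "?r ` col A n \<subseteq> {..n} \<rightarrow>\<^sub>E {0,1,2,3}"
  proof clarify
    fix c assume "c \<in> col A n"
    then show "?r c \<in> {..n} \<rightarrow>\<^sub>E {0,1,2,3}" using col_values(2)[of c n] by (simp add: PiE_iff)
  qed
  ultimately have "card (col A n) \<le> card ({..n} \<rightarrow>\<^sub>E {0,1,2,3::nat})"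
    by (intro card_inj_on_le) (auto intro: finite_PiE)
  also have "\<dots> = card {0,1,2,3::nat} ^ (n + 1)" by (simp add: card_PiE)
  also have "card {0,1,2,3::nat} = 4" by simp
  finally show ?thesis .
qed

text \<open>Up to \<open>p\<close> the monochromatic pairs leave few colourings by
  \<open>card_pal\<close>; above \<open>p\<close> every node has at most two options.\<close>

lemma card_last_pal:
  assumes "p \<le> m"
  shows "card {c \<in> col A m. pal c p \<and> (\<forall>v\<in>{p<..m}. v \<in> A \<longrightarrow> \<not> pal c v)}
    \<le> 3 ^ (p div 2 + 1) * 2 ^ (m - p)"
proof -
  let ?G = "{c \<in> col A m. pal c p \<and> (\<forall>v\<in>{p<..m}. v \<in> A \<longrightarrow> \<not> pal c v)}"
  \<comment> \<open>With \<open>t = 0\<close> the weighted bound is a plain count of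
    branches.\<close>
  have *: "card {c \<in> ?G. 0 \<le> card {v \<in> {p<..m}. card (palette A c v) \<le> 1}} * 2 ^ 0
    \<le> card (trunc p ` ?G) * 2 ^ (m - p)"
  proof (rule branching_count)
    show "finite ?G" using finite_col by auto
    fix c assume "c \<in> ?G"
    then have c: "c \<in> col A m" and np: "\<forall>v\<in>{p<..m}. v \<in> A \<longrightarrow> \<not> pal c v" by auto
    show "c x = 0" if "x > m" for x using col_values(1)[OF c, of x] that by simp
    fix v assume v: "p < v" "v \<le> m"
    show "palette A (trunc (v - 1) c) v = palette A c v" using palette_trunc[OF c] v by simp
    show "c v \<in> palette A c v \<and> finite (palette A c v) \<and> card (palette A c v) \<le> 2"
      using in_palette[OF c] finite_palette card_palette_not_pal[OF c] np v by auto
  qed fact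
  have "trunc p ` ?G \<subseteq> {c \<in> col A p. pal c p}"
  proof clarify
    fix c assume c: "c \<in> col A m" "pal c p"
    then show "trunc p c \<in> col A p \<and> pal (trunc p c) p"
      using trunc_col[OF c(1) assms] by (simp add: pal_def trunc_def)
  qed
  then have "card (trunc p ` ?G) \<le> card {c \<in> col A p. pal c p}"
    using finite_col by (intro card_mono) auto
  also have "\<dots> \<le> 3 ^ (p div 2 + 1)" by (rule card_pal)
  finally have "card (trunc p ` ?G) * 2 ^ (m - p) \<le> 3 ^ (p div 2 + 1) * 2 ^ (m - p)"
    by (rule mult_le_mono1)
  moreover have "card ?G \<le> card (trunc p ` ?G) * 2 ^ (m - p)" using * by simp
  ultimately show ?thesis by (rule le_trans[rotated])
qed

section \<open>Colourings with one colour class symmetric under reflection\<close>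

text \<open>If colour \<open>k\<close> is the only one forbidden at \<open>Suc m\<close>, then its occurrences are symmetric under
  \<open>x \<mapsto> Suc m - x\<close> within \<open>A\<close>. An element \<open>v\<close> of the upper half then has a single option unless both \<open>v\<close> and
  its mirror image avoid \<open>k\<close>.\<close>

definition sym_col :: "nat \<Rightarrow> nat \<Rightarrow> nat \<Rightarrow> (nat \<Rightarrow> nat) set" where
  "sym_col k M m = {c \<in> col A m. (\<forall>v\<in>{M<..m}. v \<in> A \<longrightarrow> \<not> pal c v) \<and>
     (\<forall>x y. x + y = Suc m \<longrightarrow> c x \<noteq> 0 \<longrightarrow> c y \<noteq> 0 \<longrightarrow> (c x = k \<longleftrightarrow> c y = k))}"

text \<open>The symmetry is imposed only where \<open>Suc m < 2 * v\<close>: there the mirror image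
  \<open>Suc m - v\<close> precedes \<open>v\<close>, so the options still depend on the past
  alone.\<close>

definition sym_opt :: "nat \<Rightarrow> nat \<Rightarrow> (nat \<Rightarrow> nat) \<Rightarrow> nat \<Rightarrow> nat set" where
  "sym_opt k m c v = {i \<in> palette A c v.
     Suc m < 2 * v \<longrightarrow> v \<in> A \<longrightarrow> Suc m - v \<in> A \<longrightarrow> (i = k \<longleftrightarrow> c (Suc m - v) = k)}"

definition sym_single :: "nat \<Rightarrow> nat \<Rightarrow> nat \<Rightarrow> (nat \<Rightarrow> nat) \<Rightarrow> nat set" where
  "sym_single k M m c = {v \<in> {M<..m}. card (sym_opt k m c v) \<le> 1}"

text \<open>The tree count started at level \<open>M\<close>, where there are at most
  \<open>4 ^ (M + 1)\<close> nodes. Taking \<open>t\<close> large in terms of \<open>M\<close> makes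
  this family negligible against \<open>2 ^ m\<close>.\<close>

lemma card_sym_col_many_single:
  assumes "M \<le> m"
  shows "card {c \<in> sym_col k M m. t \<le> card (sym_single k M m c)} * 2 ^ t \<le> 4 ^ (M + 1) * 2 ^ (m - M)"
proof -
  have "card {c \<in> sym_col k M m. t \<le> card (sym_single k M m c)} * 2 ^ t
    \<le> card (trunc M ` sym_col k M m) * 2 ^ (m - M)"
    unfolding sym_single_def
  proof (rule branching_count)
    show "finite (sym_col k M m)" using finite_col by (simp add: sym_col_def)
    fix c assume "c \<in> sym_col k M m"
    then have c: "c \<in> col A m" and np: "\<forall>v\<in>{M<..m}. v \<in> A \<longrightarrow> \<not> pal c v"
      and sy: "\<And>x y. x + y = Suc m \<Longrightarrow> c x \<noteq> 0 \<Longrightarrow> c y \<noteq> 0 \<Longrightarrow> (c x = k \<longleftrightarrow> c y = k)"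
      by (auto simp: sym_col_def)
    show "c x = 0" if "x > m" for x using col_values(1)[OF c, of x] that by simp
    fix v assume v: "M < v" "v \<le> m"
    have "trunc (v - 1) c (Suc m - v) = c (Suc m - v)" if "Suc m < 2 * v"
      using that by (auto simp: trunc_def)
    then show "sym_opt k m (trunc (v - 1) c) v = sym_opt k m c v"
      using palette_trunc[OF c, of v] v unfolding sym_opt_def by auto
    have "c v = k \<longleftrightarrow> c (Suc m - v) = k" if "v \<in> A" "Suc m - v \<in> A"
    proof -
      have "Suc m - v \<noteq> 0" using that zero by metis
      then have "c v \<noteq> 0" "c (Suc m - v) \<noteq> 0" using col_values(1)[OF c] that v by auto
      then show ?thesis using sy[of v "Suc m - v"] v by simp
    qed
    then have "c v \<in> sym_opt k m c v" using in_palette[OF c] v by (simp add: sym_opt_def)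
    moreover have "sym_opt k m c v \<subseteq> palette A c v" by (auto simp: sym_opt_def)
    moreover have "card (palette A c v) \<le> 2" using card_palette_not_pal[OF c] np v by auto
    ultimately show "c v \<in> sym_opt k m c v \<and> finite (sym_opt k m c v) \<and> card (sym_opt k m c v) \<le> 2"
      using card_mono[OF finite_palette, of "sym_opt k m c v" c v]
        finite_subset[OF _ finite_palette, of "sym_opt k m c v" c v] by simp
  qed fact
  also have "card (trunc M ` sym_col k M m) \<le> card (col A M)"
    using finite_col trunc_col assms by (intro card_mono) (auto simp: sym_col_def)
  also have "\<dots> \<le> 4 ^ (M + 1)" by (rule card_col)
  finally show ?thesis by simp
qed

text \<open>Above \<open>M\<close>, gaps of \<open>A\<close> are single-option nodes, and so are the
  upper elements of mirror pairs in \<open>A\<close> coloured \<open>k\<close>. If such nodes are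
  few, then \<open>k\<close> is rare and \<open>A\<close> is almost all of \<open>{1..m}\<close>;
  together these make one occurrence of \<open>k\<close> very restrictive.\<close>

lemma sym_col_few_single:
  assumes c: "c \<in> sym_col k M m" and k: "k \<in> {1,2,3}" and S: "card (sym_single k M m c) < t"
  shows "card {x. c x = k} \<le> 2 * M + 2 * t + 2" and "card ({1..m} - A) \<le> 2 * M + 2 * t + 2"
proof -
  let ?S = "sym_single k M m c"
  have fS: "finite ?S" by (simp add: sym_single_def)
  have col: "c \<in> col A m"
    and sy: "\<And>x y. x + y = Suc m \<Longrightarrow> c x \<noteq> 0 \<Longrightarrow> c y \<noteq> 0 \<Longrightarrow> (c x = k \<longleftrightarrow> c y = k)"
    using c by (auto simp: sym_col_def)
  have missing: "v \<in> ?S" if "M < v" "v \<le> m" "v \<notin> A" for v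
  proof -
    have "sym_opt k m c v \<subseteq> {0}" using that(3) by (auto simp: sym_opt_def palette_def)
    from card_mono[OF _ this] have "card (sym_opt k m c v) \<le> 1" by simp
    then show ?thesis using that by (simp add: sym_single_def)
  qed
  have upper: "v \<in> ?S" if "M < v" "v \<le> m" "Suc m < 2 * v" "v \<in> A" "Suc m - v \<in> A" "c v = k \<or> c (Suc m - v) = k" for v
  proof -
    have "Suc m - v \<noteq> 0" using that zero by metis
    then have "c v \<noteq> 0" "c (Suc m - v) \<noteq> 0" using col_values(1)[OF col] that by auto
    then have "c (Suc m - v) = k" using sy[of v "Suc m - v"] that by auto
    then have "sym_opt k m c v \<subseteq> {k}" using that by (auto simp: sym_opt_def)
    from card_mono[OF _ this] have "card (sym_opt k m c v) \<le> 1" by simp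
    then show ?thesis using that by (simp add: sym_single_def)
  qed
  \<comment> \<open>The bottom, its mirror image, the midpoint, the single-option nodes and their
    mirror images: at most \<open>M + 1\<close>, \<open>M\<close>, \<open>1\<close> and twice
    \<open>card ?S\<close> positions.\<close>
  let ?U = "{..M} \<union> {Suc m - M..m} \<union> {Suc m div 2} \<union> ?S \<union> (\<lambda>v. Suc m - v) ` ?S"
  have sub: "{x. c x = k} \<subseteq> ?U"
  proof
    fix x assume "x \<in> {x. c x = k}"
    then have x: "c x = k" by simp
    then have "c x \<noteq> 0" using k by auto
    then have xA: "x \<in> A" "x \<le> m" using col_values(1)[OF col] by auto
    have mir: "Suc m - (Suc m - x) = x" using xA by simp
    have *: "x \<in> ?U" if "Suc m - x \<in> ?S" using imageI[OF that, of "\<lambda>v. Suc m - v"] mir by simp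
    show "x \<in> ?U"
    proof (cases "x \<le> M \<or> Suc m - x \<le> M \<or> 2 * x = Suc m")
      case True
      then show ?thesis using xA by auto
    next
      case False
      then have f: "M < x" "M < Suc m - x" "2 * x \<noteq> Suc m" by auto
      have x0: "x \<noteq> 0" using xA zero by metis
      show ?thesis
      proof (cases "Suc m - x \<in> A")
        \<comment> \<open>A gap at the mirror image is itself a single-option node, so
          \<open>x\<close> lies in the reflected copy of \<open>?S\<close>.\<close>
        case nA: False
        then show ?thesis using missing[of "Suc m - x"] f x0 * by simp
      next
        case mA: True
        show ?thesis
        proof (cases "2 * x < Suc m")
          case True
          then have "Suc m - x \<in> ?S" using upper[of "Suc m - x"] f x0 xA mA x mir by simp
          then show ?thesis by (rule *)
        next
          case False
          then have "x \<in> ?S" using upper[of x] f xA mA x by simp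
          then show ?thesis by simp
        qed
      qed
    qed
  qed
  have "card ?U \<le> card {..M} + card {Suc m - M..m} + card {Suc m div 2} + card ?S
      + card ((\<lambda>v. Suc m - v) ` ?S)"
    by (intro order.trans[OF card_Un_le] add_mono order.refl)
  also have "\<dots> \<le> card {..M} + card {Suc m - M..m} + card {Suc m div 2} + card ?S + card ?S"
    using fS by (intro add_mono card_image_le order.refl)
  also have "\<dots> \<le> 2 * M + 2 * t + 2" using S by simp
  finally show "card {x. c x = k} \<le> 2 * M + 2 * t + 2"
    using card_mono[OF _ sub] fS by simp
  have "{1..m} - A \<subseteq> {..M} \<union> ?S"
  proof
    fix v assume "v \<in> {1..m} - A"
    then show "v \<in> {..M} \<union> ?S" using missing[of v] by (cases "v \<le> M") auto
  qed
  then have "card ({1..m} - A) \<le> card ({..M} \<union> ?S)" using fS by (intro card_mono) auto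
  also have "\<dots> \<le> card {..M} + card ?S" by (rule card_Un_le)
  also have "\<dots> \<le> 2 * M + 2 * t + 2" using S by simp
  finally show "card ({1..m} - A) \<le> 2 * M + 2 * t + 2" .
qed

section \<open>Colourings with a rare but occurring colour\<close>

text \<open>Since \<open>z\<close> has colour \<open>k\<close>, two elements of \<open>A\<close>
  outside \<open>C\<close> that form a sum with \<open>z\<close> must share their colour. So
  \<open>v\<close> copies \<open>v - z\<close> if \<open>v > z\<close>, and \<open>z - v\<close> if
  \<open>z / 2 < v < z\<close>. This forces roughly half of the nodes or more, except where the
  partner lies in \<open>C\<close> or is a gap.\<close>

lemma card_class_eq:
  assumes k: "k \<in> {1,2,3}" and z: "z \<in> C" and C: "C \<subseteq> A \<inter> {1..m}" "card C \<le> K"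
    and miss: "card ({1..m} - A) \<le> K"
  shows "card {c \<in> col A m. {x. c x = k} = C} \<le> 2 ^ (m div 2 + 1 + 4 * K)"
proof -
  let ?G = "{c \<in> col A m. {x. c x = k} = C}"
  \<comment> \<open>As \<open>C\<close> is prescribed, \<open>k\<close> is used exactly on
    \<open>C\<close> and at most two colours remain elsewhere. The restriction \<open>x < v\<close>
    keeps the options dependent on the past.\<close>
  define Opt where "Opt = (\<lambda>(c::nat\<Rightarrow>nat) v. if v \<in> C then {k} else if v \<notin> A then {0} else
     {i \<in> {1,2,3} - {k}. \<forall>x\<in>A - C. x < v \<longrightarrow> x + z = v \<or> x + v = z \<longrightarrow> i = c x})"
  define D where "D = {z<..m} \<union> {z div 2<..<z}"
  define B where "B = C \<union> ({1..m} - A)"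
  have zm: "1 \<le> z" "z \<le> m" "z \<in> A" using z C by auto
  have "card D = (m - z) + (z - Suc (z div 2))"
    unfolding D_def by (subst card_Un_disjoint) (simp_all add: disjoint_iff)
  \<comment> \<open>The cardinality is \<open>m - 1 - z div 2\<close>, smallest at
    \<open>z = m\<close>.\<close>
  then have D: "m - 1 - m div 2 \<le> card D" using zm by linarith
  have "finite C" using C finite_subset by blast
  then have "finite B" by (simp add: B_def)
  have B: "card B \<le> 2 * K"
    using card_Un_le[of C "{1..m} - A"] C(2) miss unfolding B_def by linarith
  have single: "m - 1 - m div 2 - 4 * K \<le> card {v \<in> {0<..m}. card (Opt c v) \<le> 1}"
    if c: "c \<in> ?G" for c
  proof -
    let ?S = "{v \<in> {0<..m}. card (Opt c v) \<le> 1}"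
    have forced: "v \<in> ?S" if v: "v \<in> {1..m}" and x: "x \<in> A - C" "x < v" "x + z = v \<or> x + v = z" for v x
    proof -
      obtain a where "Opt c v \<subseteq> {a}"
      proof (cases "v \<in> C \<or> v \<notin> A")
        case True
        then have "Opt c v \<subseteq> {if v \<in> C then k else 0}" by (elim disjE) (simp_all add: Opt_def)
        then show ?thesis by (rule that)
      next
        case False
        have "i = c x" if "i \<in> Opt c v" for i
          using that False x unfolding Opt_def by auto
        then show ?thesis using that by blast
      qed
      from card_mono[OF _ this] show ?thesis using v by simp
    qed
    \<comment> \<open>Each of the at most \<open>2 * K\<close> elements of \<open>B\<close> spoils
      at most the two nodes \<open>x + z\<close> and \<open>z - x\<close>; this is the loss
      \<open>4 * K\<close>.\<close>
    have "D \<subseteq> ?S \<union> ((\<lambda>x. x + z) ` B \<union> (\<lambda>x. z - x) ` B)"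
    proof
      fix v assume "v \<in> D"
      then consider "z < v" "v \<le> m" | "z div 2 < v" "v < z" by (auto simp: D_def)
      then show "v \<in> ?S \<union> ((\<lambda>x. x + z) ` B \<union> (\<lambda>x. z - x) ` B)"
      proof cases
        case 1
        then have v: "v - z \<in> {1..m}" "v - z + z = v" by auto
        show ?thesis
        proof (cases "v - z \<in> B")
          case True
          then have "v \<in> (\<lambda>x. x + z) ` B" using v by (metis imageI)
          then show ?thesis by blast
        next
          case False
          then have "v \<in> ?S" using v 1 zm by (intro forced[of v "v - z"]) (auto simp: B_def)
          then show ?thesis by blast
        qed
      next
        case 2
        then have v: "z - v \<in> {1..m}" "z - (z - v) = v" using zm by auto
        show ?thesis
        proof (cases "z - v \<in> B")
          case True
          then have "v \<in> (\<lambda>x. z - x) ` B" using v by (metis imageI)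
          then show ?thesis by blast
        next
          case False
          then have "v \<in> ?S" using v 2 zm by (intro forced[of v "z - v"]) (auto simp: B_def)
          then show ?thesis by blast
        qed
      qed
    qed
    then have "card D \<le> card (?S \<union> ((\<lambda>x. x + z) ` B \<union> (\<lambda>x. z - x) ` B))"
      using \<open>finite B\<close> by (intro card_mono) auto
    also have "\<dots> \<le> card ?S + (card ((\<lambda>x. x + z) ` B) + card ((\<lambda>x. z - x) ` B))"
      by (intro order.trans[OF card_Un_le] add_mono order.refl)
    also have "\<dots> \<le> card ?S + (card B + card B)"
      using \<open>finite B\<close> by (intro add_mono card_image_le) auto
    finally show ?thesis using B D by linarith
  qed
  let ?t = "m - 1 - m div 2 - 4 * K"
  have "card {c \<in> ?G. ?t \<le> card {v \<in> {0<..m}. card (Opt c v) \<le> 1}} * 2 ^ ?t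
    \<le> card (trunc 0 ` ?G) * 2 ^ (m - 0)"
  proof (rule branching_count)
    show "finite ?G" using finite_col by simp
    fix c assume "c \<in> ?G"
    then have c: "c \<in> col A m" and cC: "\<And>x. c x = k \<longleftrightarrow> x \<in> C" by auto
    show "c x = 0" if "x > m" for x using col_values(1)[OF c, of x] that by simp
    fix v assume v: "0 < v" "v \<le> m"
    show "Opt (trunc (v - 1) c) v = Opt c v"
    proof -
      have "trunc (v - 1) c x = c x" if "x < v" for x using that by (auto simp: trunc_def)
      then show ?thesis unfolding Opt_def by (simp cong: conj_cong)
    qed
    have "c v \<in> Opt c v"
    proof (cases "v \<in> C \<or> v \<notin> A")
      case True
      then show ?thesis using cC[of v] col_values(1)[OF c, of v] by (auto simp: Opt_def)
    next
      case False
      have "c v = c x" if x: "x \<in> A - C" "x < v" "x + z = v \<or> x + v = z" for x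
      proof -
        have "c x \<noteq> k" "c v \<noteq> k" "c z = k" using cC x False z by auto
        moreover have "c x \<noteq> 0" "c v \<noteq> 0" "c z \<noteq> 0"
          using col_values(1)[OF c] x False zm v by auto
        ultimately show ?thesis
          using col_no_rainbow[OF c, of x z] col_no_rainbow[OF c, of x v] x(3) by auto
      qed
      moreover have "c v \<in> {1,2,3} - {k}" using col_values(3)[OF c] False v cC by auto
      ultimately show ?thesis using False by (auto simp: Opt_def)
    qed
    moreover obtain X where X: "Opt c v \<subseteq> X" "finite X" "card X \<le> 2"
    proof (cases "v \<in> C \<or> v \<notin> A")
      case True
      then show ?thesis by (intro that[of "Opt c v"]) (auto simp: Opt_def)
    next
      case False
      then show ?thesis using k by (intro that[of "{1,2,3} - {k}"]) (auto simp: Opt_def)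
    qed
    ultimately show "c v \<in> Opt c v \<and> finite (Opt c v) \<and> card (Opt c v) \<le> 2"
      using card_mono[OF X(2,1)] finite_subset[OF X(1,2)] by simp
  qed simp
  moreover have "{c \<in> ?G. ?t \<le> card {v \<in> {0<..m}. card (Opt c v) \<le> 1}} = ?G"
    using single by blast
  moreover have "card (trunc 0 ` ?G) \<le> 1"
  proof -
    have "trunc 0 c = (\<lambda>_. 0)" if "c \<in> ?G" for c
    proof -
      have "c 0 = 0" using col_values(1)[of c m 0] that zero by simp
      then show ?thesis by (auto simp: trunc_def)
    qed
    then have "trunc 0 ` ?G \<subseteq> {\<lambda>_. 0}" by blast
    from card_mono[OF _ this] show ?thesis by simp
  qed
  ultimately have "card ?G * 2 ^ ?t \<le> card (trunc 0 ` ?G) * 2 ^ m" "card (trunc 0 ` ?G) \<le> 1" by simp_all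
  then have "card ?G * 2 ^ ?t \<le> 1 * 2 ^ m" by (meson le_trans mult_le_mono1)
  \<comment> \<open>The exponents on the right add up to at least \<open>m\<close>, even when the
    subtraction in \<open>?t\<close> is cut off at \<open>0\<close>.\<close>
  also have "\<dots> \<le> 2 ^ (m div 2 + 1 + 4 * K) * 2 ^ ?t"
    unfolding power_add[symmetric] by (simp del: power_Suc add: power_increasing)
  finally show ?thesis by simp
qed

text \<open>A nonempty set of at most \<open>K\<close> elements is the range of a list of length
  exactly \<open>K\<close>, padded by repeating one of its elements.\<close>

lemma card_small_subsets:
  assumes "finite X"
  shows "card {C. C \<subseteq> X \<and> C \<noteq> {} \<and> card C \<le> K} \<le> card X ^ K"
proof -
  have "{C. C \<subseteq> X \<and> C \<noteq> {} \<and> card C \<le> K} \<subseteq> set ` {xs. set xs \<subseteq> X \<and> length xs = K}"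
  proof
    fix C assume "C \<in> {C. C \<subseteq> X \<and> C \<noteq> {} \<and> card C \<le> K}"
    then have C: "C \<subseteq> X" "C \<noteq> {}" "card C \<le> K" by auto
    then obtain xs where xs: "set xs = C" "distinct xs"
      using assms finite_distinct_list finite_subset by metis
    then have len: "length xs = card C" by (metis distinct_card)
    obtain a where a: "a \<in> C" using C by blast
    let ?ys = "xs @ replicate (K - card C) a"
    have "set ?ys = C" using xs a by auto
    moreover have "length ?ys = K" using len C by simp
    ultimately show "C \<in> set ` {xs. set xs \<subseteq> X \<and> length xs = K}" using C(1) by blast
  qed
  then have "card {C. C \<subseteq> X \<and> C \<noteq> {} \<and> card C \<le> K} \<le> card (set ` {xs. set xs \<subseteq> X \<and> length xs = K})"
    using assms by (intro card_mono finite_imageI finite_lists_length_eq)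
  also have "\<dots> \<le> card {xs. set xs \<subseteq> X \<and> length xs = K}"
    using assms by (intro card_image_le finite_lists_length_eq)
  also have "\<dots> = card X ^ K" using assms by (rule card_lists_length_eq)
  finally show ?thesis .
qed

text \<open>The union bound over the possible classes of \<open>k\<close> costs only a polynomial
  factor for fixed \<open>K\<close>.\<close>

lemma card_class_small:
  assumes k: "k \<in> {1,2,3}" and miss: "card ({1..m} - A) \<le> K"
  shows "card {c \<in> col A m. {x. c x = k} \<noteq> {} \<and> card {x. c x = k} \<le> K} \<le> m ^ K * 2 ^ (m div 2 + 1 + 4 * K)"
proof -
  let ?I = "{C. C \<subseteq> A \<inter> {1..m} \<and> C \<noteq> {} \<and> card C \<le> K}"
  let ?G = "\<lambda>C. {c \<in> col A m. {x. c x = k} = C}"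
  have fI: "finite ?I" by (rule finite_subset[of _ "Pow {1..m}"]) auto
  have "{c \<in> col A m. {x. c x = k} \<noteq> {} \<and> card {x. c x = k} \<le> K} \<subseteq> (\<Union>C\<in>?I. ?G C)"
  proof
    fix c assume c: "c \<in> {c \<in> col A m. {x. c x = k} \<noteq> {} \<and> card {x. c x = k} \<le> K}"
    have "{x. c x = k} \<subseteq> A \<inter> {1..m}"
    proof
      fix x assume "x \<in> {x. c x = k}"
      then have "c x \<noteq> 0" using k by auto
      then have "x \<in> A" "x \<le> m" using col_values(1)[of c m x] c by auto
      moreover have "x \<noteq> 0" using zero calculation by metis
      ultimately show "x \<in> A \<inter> {1..m}" by simp
    qed
    then show "c \<in> (\<Union>C\<in>?I. ?G C)" using c by blast
  qed
  then have "card {c \<in> col A m. {x. c x = k} \<noteq> {} \<and> card {x. c x = k} \<le> K} \<le> card (\<Union>C\<in>?I. ?G C)"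
    using fI finite_col by (intro card_mono) auto
  also have "\<dots> \<le> (\<Sum>C\<in>?I. card (?G C))" using fI by (rule card_UN_le)
  also have "\<dots> \<le> (\<Sum>C\<in>?I. 2 ^ (m div 2 + 1 + 4 * K))"
  proof (rule sum_mono)
    fix C assume C: "C \<in> ?I"
    then obtain z where "z \<in> C" by blast
    then show "card (?G C) \<le> 2 ^ (m div 2 + 1 + 4 * K)" using C by (intro card_class_eq[OF k _ _ _ miss]) auto
  qed
  also have "\<dots> = card ?I * 2 ^ (m div 2 + 1 + 4 * K)" by simp
  also have "card ?I \<le> card (A \<inter> {1..m}) ^ K" by (rule card_small_subsets) simp
  also have "card (A \<inter> {1..m}) ^ K \<le> m ^ K" using card_mono[of "{1..m}" "A \<inter> {1..m}"] by (intro power_mono) auto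
  finally show ?thesis by simp
qed

section \<open>Growth of the number of colourings using all three colours\<close>

definition tricol :: "nat \<Rightarrow> (nat \<Rightarrow> nat) set" where
  "tricol m = {c \<in> col A m. \<forall>k\<in>{1,2,3}. \<exists>x. c x = k}"

text \<open>The nodes with exactly two options at \<open>Suc m\<close>; full palettes are counted
  apart, by \<open>card_pal\<close>.\<close>

definition two_ext :: "nat \<Rightarrow> (nat \<Rightarrow> nat) set" where
  "two_ext m = {c \<in> tricol m. Suc m \<in> A \<and> card (palette A c (Suc m)) = 2}"

lemma finite_tricol: "finite (tricol m)"
  using finite_col by (simp add: tricol_def)

text \<open>Either some element of \<open>A\<close> above \<open>M\<close> satisfies
  \<open>pal\<close>, and \<open>p\<close> is the last one, or none does. In the second case let
  \<open>k\<close> be the colour missing from the palette at \<open>Suc m\<close>: a pair with sum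
  \<open>Suc m\<close> having exactly one member coloured \<open>k\<close> would leave at most one
  option there.\<close>

lemma two_ext_cases:
  assumes c: "c \<in> two_ext m"
  shows "(\<exists>p\<in>{M<..m}. pal c p \<and> (\<forall>v\<in>{p<..m}. v \<in> A \<longrightarrow> \<not> pal c v)) \<or>
    (\<exists>k\<in>{1,2,3}. c \<in> sym_col k M m)"
proof (cases "\<exists>p\<in>{M<..m}. p \<in> A \<and> pal c p")
  case True
  let ?P = "{p \<in> {M<..m}. p \<in> A \<and> pal c p}"
  have P: "finite ?P" "?P \<noteq> {}" using True by auto
  then have "Max ?P \<in> ?P" by (rule Max_in)
  moreover have "v \<notin> ?P" if "v > Max ?P" for v using Max_ge[OF P(1), of v] that by linarith
  ultimately have "Max ?P \<in> {M<..m} \<and> pal c (Max ?P) \<and> (\<forall>v\<in>{Max ?P<..m}. v \<in> A \<longrightarrow> \<not> pal c v)"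
    by (simp del: Max_gr_iff Max_less_iff)
  then show ?thesis by blast
next
  case False
  let ?R = "palette A c (Suc m)"
  have col: "c \<in> col A m" and mA: "Suc m \<in> A" and R: "card ?R = 2"
    using c by (auto simp: two_ext_def tricol_def)
  have R3: "?R \<subseteq> {1,2,3}" using mA by (auto simp: palette_def)
  then have "card ({1,2,3} - ?R) = 1" using R card_Diff_subset[OF finite_palette R3] by simp
  then obtain k where k: "{1,2,3} - ?R = {k}" by (rule card_1_singletonE)
  have "c x = k \<longleftrightarrow> c y = k" if xy: "x + y = Suc m" "c x \<noteq> 0" "c y \<noteq> 0" for x y
  proof (rule ccontr)
    assume ne: "\<not> (c x = k \<longleftrightarrow> c y = k)"
    have "i = c x \<or> i = c y" if "i \<in> ?R" for i
    proof -
      have "c x = c y \<or> i = c x \<or> i = c y" using that mA xy by (simp add: palette_def)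
      then show ?thesis using ne by metis
    qed
    moreover have "k \<notin> ?R" using k by blast
    ultimately have "?R \<subseteq> (if c x = k then {c y} else {c x})" using ne by auto
    from card_mono[OF _ this] show False using R by (cases "c x = k") simp_all
  qed
  moreover have "k \<in> {1,2,3}" using k by blast
  ultimately show ?thesis using False col unfolding sym_col_def by blast
qed

text \<open>Three sources: a late full palette, a symmetric colouring with many single-option nodes,
  and one with few. In the last, \<open>k\<close> is rare, yet it occurs because all three colours
  are used, so \<open>card_class_small\<close> applies.\<close>

lemma card_two_ext:
  assumes M: "M \<le> m" and K: "K = 2 * M + 2 * t + 2"
  shows "card (two_ext m) \<le> (\<Sum>p\<in>{M<..m}. 3 ^ (p div 2 + 1) * 2 ^ (m - p)) +
    3 * (card {c \<in> sym_col 1 M m. t \<le> card (sym_single 1 M m c)} +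
      card {c \<in> sym_col 2 M m. t \<le> card (sym_single 2 M m c)} +
      card {c \<in> sym_col 3 M m. t \<le> card (sym_single 3 M m c)} + m ^ K * 2 ^ (m div 2 + 1 + 4 * K))"
proof -
  let ?L = "\<lambda>p. {c \<in> col A m. pal c p \<and> (\<forall>v\<in>{p<..m}. v \<in> A \<longrightarrow> \<not> pal c v)}"
  let ?H = "\<lambda>k. {c \<in> sym_col k M m. t \<le> card (sym_single k M m c)}"
  let ?J = "\<lambda>k. {c \<in> two_ext m. c \<in> sym_col k M m \<and> card (sym_single k M m c) < t}"
  have fin: "finite (sym_col k M m)" "finite (?J k)" for k
    using finite_col finite_tricol by (auto simp: sym_col_def two_ext_def)
  have J: "card (?J k) \<le> m ^ K * 2 ^ (m div 2 + 1 + 4 * K)" if k: "k \<in> {1,2,3}" for k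
  \<comment> \<open>The bound on the gaps of \<open>A\<close> is read off from a member of the
    family, so the empty family is treated separately.\<close>
  proof (cases "?J k = {}")
    case True
    then show ?thesis by (simp only: card.empty)
  next
    case False
    then obtain c where "c \<in> sym_col k M m" "card (sym_single k M m c) < t" by auto
    from sym_col_few_single(2)[OF this(1) k this(2)]
    have miss: "card ({1..m} - A) \<le> K" using K by simp
    have "?J k \<subseteq> {c \<in> col A m. {x. c x = k} \<noteq> {} \<and> card {x. c x = k} \<le> K}"
    proof
      fix c assume c: "c \<in> ?J k"
      then have "c \<in> col A m" "{x. c x = k} \<noteq> {}"
        using k by (auto simp: two_ext_def tricol_def)
      moreover have "card {x. c x = k} \<le> K"
        using sym_col_few_single(1)[of c k M m t] c k K by blast
      ultimately show "c \<in> {c \<in> col A m. {x. c x = k} \<noteq> {} \<and> card {x. c x = k} \<le> K}" by blast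
    qed
    then have "card (?J k) \<le> card {c \<in> col A m. {x. c x = k} \<noteq> {} \<and> card {x. c x = k} \<le> K}"
      using finite_col by (intro card_mono) auto
    also have "\<dots> \<le> m ^ K * 2 ^ (m div 2 + 1 + 4 * K)" by (rule card_class_small[OF k miss])
    finally show ?thesis .
  qed
  have "two_ext m \<subseteq> (\<Union>p\<in>{M<..m}. ?L p) \<union> (\<Union>k\<in>{1,2,3}. ?H k \<union> ?J k)"
  proof
    fix c assume c: "c \<in> two_ext m"
    then have "c \<in> col A m" by (simp add: two_ext_def tricol_def)
    then show "c \<in> (\<Union>p\<in>{M<..m}. ?L p) \<union> (\<Union>k\<in>{1,2,3}. ?H k \<union> ?J k)"
      using two_ext_cases[OF c, of M]
    proof (elim disjE bexE)
      fix k assume k: "k \<in> {1,2,3}" "c \<in> sym_col k M m"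
      then have "c \<in> ?H k \<union> ?J k" using c by (simp add: linorder_not_less[symmetric])
      with k(1) show ?thesis by blast
    qed blast
  qed
  then have "card (two_ext m) \<le> card ((\<Union>p\<in>{M<..m}. ?L p) \<union> (\<Union>k\<in>{1,2,3}. ?H k \<union> ?J k))"
    using finite_col fin by (intro card_mono) auto
  also have "\<dots> \<le> (\<Sum>p\<in>{M<..m}. card (?L p)) + (\<Sum>k\<in>{1,2,3}. card (?H k) + card (?J k))"
    by (intro order.trans[OF card_Un_le] add_mono order.trans[OF card_UN_le] sum_mono card_Un_le order.refl) auto
  also have "(\<Sum>p\<in>{M<..m}. card (?L p)) \<le> (\<Sum>p\<in>{M<..m}. 3 ^ (p div 2 + 1) * 2 ^ (m - p))"
    by (intro sum_mono card_last_pal) auto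
  also have "(\<Sum>k\<in>{1,2,3}. card (?H k) + card (?J k)) \<le>
    (\<Sum>k\<in>{1,2,3}. card (?H k) + m ^ K * 2 ^ (m div 2 + 1 + 4 * K))"
    by (intro sum_mono add_mono J order.refl)
  finally show ?thesis by simp
qed

text \<open>If \<open>Suc m\<close> is the sum of a bichromatic pair, it repeats one of the two
  colours, so the restriction to \<open>m\<close> still uses all three. Each restriction has at most
  one extension of this kind, or two if it lies in \<open>two_ext\<close>; the other colourings
  satisfy \<open>pal\<close>.\<close>

lemma tricol_step:
  "card (tricol (Suc m)) \<le> card (tricol m) + card (two_ext m) + 3 ^ (Suc m div 2 + 1)"
proof (cases "Suc m \<in> A")
  case False
  have "col A (Suc m) \<subseteq> col A m"
    using False unfolding col_def by (auto simp: le_Suc_eq split: if_splits)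
  then have "tricol (Suc m) \<subseteq> tricol m" by (auto simp: tricol_def)
  then have "card (tricol (Suc m)) \<le> card (tricol m)" using finite_tricol by (intro card_mono)
  then show ?thesis by simp
next
  case True
  let ?H = "{c \<in> tricol (Suc m). \<not> pal c (Suc m)}"
  have fH: "finite ?H" using finite_tricol by simp
  have tr: "trunc m c \<in> tricol m" if c: "c \<in> ?H" for c
  proof -
    have col: "c \<in> col A (Suc m)" using c by (simp add: tricol_def)
    obtain x y where xy: "x + y = Suc m" "c x \<noteq> 0" "c y \<noteq> 0" "c x \<noteq> c y"
      using c by (auto simp: pal_def)
    have "c 0 = 0" using col_values(1)[OF col, of 0] zero by simp
    then have le: "x \<le> m" "y \<le> m" using xy by (cases x; cases y; auto)+
    have "c (Suc m) = c x \<or> c (Suc m) = c y"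
      using col_no_rainbow[OF col, of x y] xy col_values(1)[OF col, of "Suc m"] True by auto
    moreover have "\<exists>w\<le>m. c w = k" if k: "k \<in> {1,2,3}" for k
    proof -
      obtain w where w: "c w = k" using c k unfolding tricol_def by blast
      then have "w \<le> Suc m" using k col_values(1)[OF col, of w] by fastforce
      then show ?thesis using w le calculation by (metis le_Suc_eq)
    qed
    moreover have "trunc m c \<in> col A m" using trunc_col[OF col] by simp
    ultimately show ?thesis unfolding tricol_def by (auto simp: trunc_def)
  qed
  have fiber: "card {c \<in> ?H. trunc m c = d} \<le> 1 + of_bool (d \<in> two_ext m)" if d: "d \<in> trunc m ` ?H" for d
  proof -
    let ?F = "{c \<in> ?H. trunc m c = d}"
    have dt: "d \<in> tricol m" using d tr by auto
    have P: "palette A c (Suc m) = palette A d (Suc m) \<and> c (Suc m) \<in> palette A c (Suc m) \<and>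
        card (palette A c (Suc m)) \<le> 2" if c: "c \<in> ?F" for c
    proof -
      have col: "c \<in> col A (Suc m)" using c by (simp add: tricol_def)
      show ?thesis
        using palette_trunc[OF col, of "Suc m"] in_palette[OF col, of "Suc m"]
          card_palette_not_pal[OF col, of "Suc m"] c by auto
    qed
    obtain c0 where c0: "c0 \<in> ?F" using d by auto
    have inj: "inj_on (\<lambda>c. c (Suc m)) ?F"
    proof (rule inj_onI, rule ext)
      fix a b x assume a: "a \<in> ?F" and b: "b \<in> ?F" and e: "a (Suc m) = b (Suc m)"
      have "trunc m a x = trunc m b x" using a b by simp
      moreover have "a x = 0" "b x = 0" if "x > Suc m"
        using col_values(1)[of a "Suc m" x] col_values(1)[of b "Suc m" x] a b that by (auto simp: tricol_def)
      ultimately show "a x = b x" using e by (cases "x \<le> m"; cases "x = Suc m") (auto simp: trunc_def)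
    qed
    have "card ?F \<le> card (palette A d (Suc m))"
      using P by (intro card_inj_on_le[OF inj _ finite_palette]) auto
    moreover have "card (palette A d (Suc m)) \<le> 2" using P[OF c0] by metis
    moreover have "d \<in> two_ext m" if "card (palette A d (Suc m)) = 2"
      using dt True that by (simp add: two_ext_def)
    ultimately show ?thesis by (cases "card (palette A d (Suc m)) = 2") auto
  qed
  have "card ?H = (\<Sum>c\<in>?H. 1)" by simp
  also have "\<dots> = (\<Sum>d\<in>trunc m ` ?H. \<Sum>c\<in>{c \<in> ?H. trunc m c = d}. 1)"
    using fH by (intro sum.group[symmetric]) auto
  also have "\<dots> = (\<Sum>d\<in>trunc m ` ?H. card {c \<in> ?H. trunc m c = d})" by simp
  also have "\<dots> \<le> (\<Sum>d\<in>trunc m ` ?H. 1 + of_bool (d \<in> two_ext m))"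
    by (intro sum_mono fiber)
  also have "\<dots> \<le> (\<Sum>d\<in>tricol m. 1 + of_bool (d \<in> two_ext m))"
    using tr finite_tricol by (intro sum_mono2) auto
  also have "\<dots> = card (tricol m) + card (tricol m \<inter> two_ext m)"
    unfolding sum.distrib using finite_tricol by (simp add: sum_of_bool_eq)
  also have "tricol m \<inter> two_ext m = two_ext m" by (auto simp: two_ext_def)
  finally have H: "card ?H \<le> card (tricol m) + card (two_ext m)" .
  have "tricol (Suc m) \<subseteq> ?H \<union> {c \<in> col A (Suc m). pal c (Suc m)}" by (auto simp: tricol_def)
  then have "card (tricol (Suc m)) \<le> card (?H \<union> {c \<in> col A (Suc m). pal c (Suc m)})"
    using fH finite_col by (intro card_mono) auto
  also have "\<dots> \<le> card ?H + card {c \<in> col A (Suc m). pal c (Suc m)}" by (rule card_Un_le)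
  finally show ?thesis using H card_pal[of "Suc m"] by linarith
qed

end

section \<open>Asymptotic estimates, uniform in \<open>A\<close>\<close>

text \<open>The base \<open>7/8\<close> comes from \<open>3 \<le> (7/4)^2\<close>, which gives
  \<open>3 ^ (p div 2) \<le> (7/4) ^ p\<close>.\<close>

lemma three_power_bound:
  assumes "p \<le> m"
  shows "real (3 ^ (p div 2 + 1) * 2 ^ (m - p)) \<le> 3 * (7/8) ^ p * 2 ^ m"
proof -
  have "(3::real) ^ (p div 2) \<le> (49/16) ^ (p div 2)" by (rule power_mono) auto
  also have "\<dots> = (7/4) ^ (2 * (p div 2))" by (simp add: power_mult power2_eq_square)
  also have "\<dots> \<le> (7/4) ^ p" by (rule power_increasing) auto
  also have "\<dots> = (7/8) ^ p * 2 ^ p" by (simp flip: power_mult_distrib)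
  finally have "3 * (3::real) ^ (p div 2) * 2 ^ (m - p) \<le> 3 * ((7/8) ^ p * 2 ^ p) * 2 ^ (m - p)"
    by (intro mult_right_mono mult_left_mono) auto
  also have "\<dots> = 3 * (7/8) ^ p * 2 ^ m"
    using assms by (simp flip: power_add)
  finally show ?thesis by simp
qed

lemma geometric_tail:
  assumes "M \<le> m"
  shows "(\<Sum>p\<in>{M<..m}. (7/8::real) ^ p) = 7 * (7/8) ^ M - 7 * (7/8) ^ m"
  using assms
proof (induction m rule: dec_induct)
  case (step m)
  then have "{M<..Suc m} = insert (Suc m) {M<..m}" by auto
  then show ?case using step by simp
qed simp

lemma two_ext_small:
  fixes e :: real
  assumes "e > 0"
  shows "\<exists>n1. \<forall>m\<ge>n1. \<forall>A. 0 \<notin> A \<longrightarrow> real (card (two_ext A m)) \<le> e * 2 ^ m"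
proof -
  \<comment> \<open>The parameters are chosen in the order \<open>M\<close>, \<open>t\<close>,
    \<open>K\<close>, \<open>m\<close>. The three sources contribute \<open>3 * 7 * e / 63\<close>,
    \<open>3 * 3 * e / 27\<close> and \<open>3 * e / 9\<close>, each \<open>e / 3\<close>, in units
    of \<open>2 ^ m\<close>.\<close>
  obtain M where M: "(7/8::real) ^ M < e / 63"
    using real_arch_pow_inv[of "e / 63" "7/8"] assms by auto
  obtain t where t: "(1/2::real) ^ t < e / (27 * 4 ^ (M + 1))"
    using real_arch_pow_inv[of "e / (27 * 4 ^ (M + 1))" "1/2"] assms by auto
  define K where "K = 2 * M + 2 * t + 2"
  have "(\<lambda>m. real m ^ K * (3/4) ^ m) \<longlonglongrightarrow> 0" by real_asymp
  moreover have "0 < e / (9 * 2 ^ (1 + 4 * K))" using assms by simp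
  ultimately have "eventually (\<lambda>m. real m ^ K * (3/4) ^ m < e / (9 * 2 ^ (1 + 4 * K))) sequentially"
    by (rule order_tendstoD(2))
  then obtain n2 where n2: "\<And>m. m \<ge> n2 \<Longrightarrow> real m ^ K * (3/4) ^ m < e / (9 * 2 ^ (1 + 4 * K))"
    by (auto simp: eventually_sequentially)
  have "real (card (two_ext A m)) \<le> e * 2 ^ m" if m: "m \<ge> max n2 M" and A: "0 \<notin> A" for m A
  proof -
    let ?H = "\<lambda>k. card {c \<in> sym_col A k M m. t \<le> card (sym_single A k M m c)}"
    have Mm: "M \<le> m" using m by simp
    have "real (\<Sum>p\<in>{M<..m}. 3 ^ (p div 2 + 1) * 2 ^ (m - p)) \<le> (\<Sum>p\<in>{M<..m}. 3 * (7/8) ^ p * 2 ^ m)"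
      unfolding of_nat_sum by (intro sum_mono three_power_bound) auto
    also have "\<dots> = 3 * (\<Sum>p\<in>{M<..m}. (7/8) ^ p) * 2 ^ m"
      by (simp add: sum_distrib_left sum_distrib_right)
    also have "\<dots> \<le> 3 * (7 * (e / 63)) * 2 ^ m"
    proof -
      have "(7/8::real) ^ m \<ge> 0" by simp
      then have "(\<Sum>p\<in>{M<..m}. (7/8::real) ^ p) \<le> 7 * (e / 63)"
        using M unfolding geometric_tail[OF Mm] by linarith
      then show ?thesis by (intro mult_right_mono mult_left_mono) auto
    qed
    finally have 1: "real (\<Sum>p\<in>{M<..m}. 3 ^ (p div 2 + 1) * 2 ^ (m - p)) \<le> e / 3 * 2 ^ m" by simp
    have 2: "real (?H k) \<le> e / 27 * 2 ^ m" for k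
    proof -
      have "real (?H k) * 2 ^ t \<le> 4 ^ (M + 1) * 2 ^ (m - M)"
        using card_sym_col_many_single[OF A Mm, of k t] of_nat_mono by fastforce
      also have "\<dots> \<le> 4 ^ (M + 1) * 2 ^ m" by (intro mult_left_mono power_increasing) auto
      finally have "real (?H k) \<le> (1/2) ^ t * (4 ^ (M + 1) * 2 ^ m)"
        by (simp add: power_divide field_simps)
      also have "\<dots> \<le> e / (27 * 4 ^ (M + 1)) * (4 ^ (M + 1) * 2 ^ m)"
        using t by (intro mult_right_mono) auto
      also have "\<dots> = e / 27 * 2 ^ m" by simp
      finally show ?thesis .
    qed
    have 3: "real (m ^ K * 2 ^ (m div 2 + 1 + 4 * K)) \<le> e / 9 * 2 ^ m"
    proof -
      \<comment> \<open>From \<open>2 \<le> (3/2)^2\<close>, the factor \<open>2 ^ (m div 2)\<close>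
        is at most \<open>(3/4) ^ m * 2 ^ m\<close>, and the decay absorbs
        \<open>m ^ K\<close>.\<close>
      have "(2::real) ^ (m div 2) \<le> (9/4) ^ (m div 2)" by (rule power_mono) auto
      also have "\<dots> = (3/2) ^ (2 * (m div 2))" by (simp add: power_mult power2_eq_square)
      also have "\<dots> \<le> (3/2) ^ m" by (rule power_increasing) auto
      also have "\<dots> = (3/4) ^ m * 2 ^ m" by (simp flip: power_mult_distrib)
      finally have "real m ^ K * 2 ^ (m div 2) * 2 ^ (1 + 4 * K)
          \<le> real m ^ K * ((3/4) ^ m * 2 ^ m) * 2 ^ (1 + 4 * K)"
        by (intro mult_right_mono mult_left_mono) auto
      also have "\<dots> = real m ^ K * (3/4) ^ m * (2 ^ m * 2 ^ (1 + 4 * K))" by (simp only: mult_ac)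
      also have "\<dots> \<le> e / (9 * 2 ^ (1 + 4 * K)) * (2 ^ m * 2 ^ (1 + 4 * K))"
        using n2[of m] m by (intro mult_right_mono) auto
      also have "\<dots> = e / 9 * 2 ^ m" by simp
      finally show ?thesis by (simp add: power_add mult_ac)
    qed
    have "real (card (two_ext A m)) \<le> real (\<Sum>p\<in>{M<..m}. 3 ^ (p div 2 + 1) * 2 ^ (m - p)) +
        3 * (real (?H 1) + real (?H 2) + real (?H 3) + real (m ^ K * 2 ^ (m div 2 + 1 + 4 * K)))"
      using of_nat_mono[OF card_two_ext[OF A Mm K_def], where ?'a = real]
      by (simp only: of_nat_add of_nat_mult of_nat_numeral)
    also have "\<dots> \<le> e * 2 ^ m"
    proof -
      have "a + 3 * (b + c + d + f) \<le> e * X"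
        if "a \<le> e / 3 * X" "b \<le> e / 27 * X" "c \<le> e / 27 * X" "d \<le> e / 27 * X" "f \<le> e / 9 * X"
        for a b c d f X :: real
        using that by (simp add: field_simps)
      from this[OF 1 2 2 2 3] show ?thesis .
    qed
    finally show ?thesis .
  qed
  then show ?thesis by blast
qed

text \<open>Normalised by \<open>2 ^ m\<close>, \<open>tricol_step\<close> reads
  \<open>u \<mapsto> (u + 3/16) / 2\<close> for large \<open>m\<close>, a contraction with fixed
  point \<open>3/16\<close>, so the initial value is forgotten. The \<open>3/16\<close> is
  \<open>1/16\<close> from \<open>two_ext\<close> plus \<open>2 * (1/16)\<close> from full
  palettes.\<close>

lemma tricol_small: "\<exists>n0. \<forall>n\<ge>n0. \<forall>A. 0 \<notin> A \<longrightarrow> 2 * card (tricol A n) \<le> 2 ^ n"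
proof -
  obtain n1 where n1: "\<And>m A. m \<ge> n1 \<Longrightarrow> 0 \<notin> A \<Longrightarrow> real (card (two_ext A m)) \<le> 1/16 * 2 ^ m"
    using two_ext_small[of "1/16"] by auto
  obtain n2 where n2: "(7/8::real) ^ n2 < 1/48"
    using real_arch_pow_inv[of "1/48" "7/8"] by auto
  define b where "b = max n1 n2"
  \<comment> \<open>After \<open>j\<close> steps the transient term is at most \<open>1/4\<close>,
    and \<open>1/4 + 3/16 < 1/2\<close>.\<close>
  obtain j where j: "(1/2::real) ^ j < 1 / (4 * 4 ^ (b + 1))"
    using real_arch_pow_inv[of "1 / (4 * 4 ^ (b + 1))" "1/2"] by auto
  have bound: "real (card (tricol A (b + i))) / 2 ^ (b + i) \<le> (1/2) ^ i * 4 ^ (b + 1) + 3/16"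
    if A: "0 \<notin> A" for A i
  proof (induction i)
    case 0
    have "card (tricol A b) \<le> card (col A b)"
      using finite_col[OF A] by (intro card_mono) (auto simp: tricol_def[OF A])
    also have "\<dots> \<le> 4 ^ (b + 1)" by (rule card_col[OF A])
    finally have "real (card (tricol A b)) \<le> 4 ^ (b + 1)" using of_nat_mono by fastforce
    then have "real (card (tricol A b)) / 2 ^ b \<le> 4 ^ (b + 1) / 1" by (intro frac_le) auto
    then show ?case by simp
  next
    case (Suc i)
    let ?m = "b + i"
    have E: "real (card (two_ext A ?m)) \<le> 1/16 * 2 ^ ?m" using n1[of ?m A] A by (simp add: b_def)
    have "(7/8::real) ^ Suc ?m \<le> (7/8) ^ n2" by (rule power_decreasing) (auto simp: b_def)
    then have P: "real (3 ^ (Suc ?m div 2 + 1)) \<le> 1/16 * 2 ^ Suc ?m"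
    proof -
      have "real (3 ^ (Suc ?m div 2 + 1)) \<le> 3 * (7/8) ^ Suc ?m * 2 ^ Suc ?m"
        using three_power_bound[of "Suc ?m" "Suc ?m"] by simp
      also have "\<dots> \<le> 1/16 * 2 ^ Suc ?m"
        using n2 \<open>(7/8::real) ^ Suc ?m \<le> (7/8) ^ n2\<close> by (intro mult_right_mono) (linarith, simp)
      finally show ?thesis .
    qed
    have "real (card (tricol A (Suc ?m))) \<le> real (card (tricol A ?m)) + real (card (two_ext A ?m)) + real (3 ^ (Suc ?m div 2 + 1))"
      using of_nat_mono[OF tricol_step[OF A, of ?m], where ?'a = real] by (simp only: of_nat_add)
    also have "\<dots> \<le> real (card (tricol A ?m)) + 3/16 * 2 ^ ?m" using E P by simp
    finally have "real (card (tricol A (Suc ?m))) / 2 ^ Suc ?m \<le> (real (card (tricol A ?m)) + 3/16 * 2 ^ ?m) / 2 ^ Suc ?m"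
      by (rule divide_right_mono) simp
    also have "\<dots> = (real (card (tricol A ?m)) / 2 ^ ?m + 3/16) / 2" by (simp add: field_simps)
    also have "\<dots> \<le> ((1/2) ^ i * 4 ^ (b + 1) + 3/16 + 3/16) / 2"
      using Suc.IH by (intro divide_right_mono add_right_mono) auto
    also have "\<dots> = (1/2) ^ Suc i * 4 ^ (b + 1) + 3/16" by simp
    finally show ?case by (simp only: add_Suc_right)
  qed
  have "2 * card (tricol A n) \<le> 2 ^ n" if n: "n \<ge> b + j" and A: "0 \<notin> A" for n A
  proof -
    define i where "i = n - b"
    have i: "n = b + i" "j \<le> i" using n by (auto simp: i_def)
    have "(1/2::real) ^ i \<le> (1/2) ^ j" using i by (intro power_decreasing) auto
    then have "(1/2) ^ i * 4 ^ (b + 1) \<le> 1 / (4 * 4 ^ (b + 1)) * (4::real) ^ (b + 1)"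
      using j by (intro mult_right_mono) (linarith, simp)
    also have "\<dots> = 1/4" by simp
    finally have "real (card (tricol A n)) / 2 ^ n \<le> 1/2"
      using bound[OF A, of i] unfolding i(1) by linarith
    then have "real (2 * card (tricol A n)) \<le> real (2 ^ n)" by (simp add: field_simps)
    then show ?thesis by (simp only: of_nat_le_iff)
  qed
  then show ?thesis by blast
qed

section \<open>Bounds for \<open>g\<close> and the comparison with the interval\<close>

lemma card_two_colors: "finite A \<Longrightarrow> k \<in> {1,2,3::nat} \<Longrightarrow> card (A \<rightarrow>\<^sub>E ({1,2,3} - {k})) = 2 ^ card A"
  by (auto simp: card_PiE numeral_2_eq_2)

text \<open>Colourings omitting some colour give the main term; the others correspond injectively to
  members of \<open>tricol A n\<close>.\<close>

lemma g_upper: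
  assumes A: "A \<subseteq> {1..n}"
  shows "g A 3 \<le> 3 * 2 ^ card A + card (tricol A n)"
proof -
  have zero: "0 \<notin> A" and fA: "finite A" using A finite_subset by auto
  let ?W = "\<lambda>k::nat. A \<rightarrow>\<^sub>E ({1,2,3} - {k})"
  let ?X = "{c \<in> colorings A 3. rainbow_sum_free A c}"
  let ?R = "?X - (\<Union>k\<in>{1,2,3}. ?W k)"
  \<comment> \<open>The value \<open>undefined\<close> off \<open>A\<close> is replaced by the dummy
    colour; nothing is lost, as extensional functions agree off \<open>A\<close>.\<close>
  let ?f = "\<lambda>c::nat\<Rightarrow>nat. \<lambda>x. if x \<in> A then c x else 0"
  have e: "{1..3} = {1,2,3::nat}" by auto
  have "inj_on ?f ?R"
  proof (rule inj_onI, rule ext)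
    fix c d x assume "c \<in> ?R" "d \<in> ?R" and f: "?f c = ?f d"
    then have "c \<in> extensional A" "d \<in> extensional A" by (auto simp: colorings_def PiE_def)
    then show "c x = d x" using fun_cong[OF f, of x] by (cases "x \<in> A") (auto simp: extensional_def)
  qed
  moreover have "?f ` ?R \<subseteq> tricol A n"
  proof
    fix d assume "d \<in> ?f ` ?R"
    then obtain c where c: "c \<in> ?R" and d: "d = ?f c" by blast
    have PE: "c \<in> A \<rightarrow>\<^sub>E {1,2,3}" and rf: "rainbow_sum_free A c" using c unfolding colorings_def e by blast+
    have val: "c x \<in> {1,2,3}" if "x \<in> A" for x using PE that by (rule PiE_mem)
    have "d x \<in> (if x \<in> A \<and> x \<le> n then {1,2,3} else {0})" for x
      using val[of x] A d by auto
    moreover have "d x = d y \<or> d x = d (x + y) \<or> d y = d (x + y)"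
      if "d x \<noteq> 0" "d y \<noteq> 0" "d (x + y) \<noteq> 0" for x y
    proof -
      have "x \<in> A" "y \<in> A" "x + y \<in> A" using that d by (auto split: if_splits)
      moreover have "x \<noteq> 0" "y \<noteq> 0" using calculation zero by metis+
      ultimately have "c x = c y \<or> c x = c (x + y) \<or> c y = c (x + y)"
        using rf unfolding rainbow_sum_free_def rainbow_sum_def by fastforce
      then show ?thesis using d \<open>x \<in> A\<close> \<open>y \<in> A\<close> \<open>x + y \<in> A\<close> by simp
    qed
    ultimately have "d \<in> col A n" by (simp add: col_def)
    moreover have "\<exists>x. d x = k" if k: "k \<in> {1,2,3}" for k
    proof (rule ccontr)
      assume "\<nexists>x. d x = k"
      then have "c x \<noteq> k" if "x \<in> A" for x using d that by metis
      then have "c \<in> ?W k" using PE by (auto simp: PiE_iff)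
      then show False using c k by blast
    qed
    ultimately show "d \<in> tricol A n" by (simp add: tricol_def[OF zero])
  qed
  ultimately have R: "card ?R \<le> card (tricol A n)"
    using finite_tricol[OF zero] by (rule card_inj_on_le)
  have fW: "finite (?W k)" for k using fA by (intro finite_PiE) auto
  have fX: "finite ?X" using finite_PiE[OF fA, of "\<lambda>_. {1..3::nat}"] by (simp add: colorings_def)
  have "g A 3 \<le> card ((\<Union>k\<in>{1,2,3}. ?W k) \<union> ?R)"
    unfolding g_def
  proof (rule card_mono)
    show "finite ((\<Union>k\<in>{1,2,3}. ?W k) \<union> ?R)"
      by (intro finite_UnI finite_UN_I fW finite_Diff fX) simp
  qed blast
  also have "\<dots> \<le> (\<Sum>k\<in>{1,2,3}. card (?W k)) + card ?R"
    by (intro order.trans[OF card_Un_le] add_mono card_UN_le order.refl) auto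
  also have "(\<Sum>k\<in>{1,2,3}. card (?W k)) = (\<Sum>k\<in>{1,2,3::nat}. 2 ^ card A)"
    using fA by (intro sum.cong card_two_colors refl)
  also have "\<dots> = 3 * 2 ^ card A" by simp
  finally show ?thesis using R by linarith
qed

text \<open>A colouring omitting a colour cannot be rainbow on any sum. The three such families
  overlap pairwise in at most one constant colouring, so inclusion-exclusion loses at most
  \<open>3\<close>.\<close>

lemma g_lower:
  assumes fA: "finite A"
  shows "3 * 2 ^ card A \<le> g A 3 + 3"
proof -
  let ?W = "\<lambda>k::nat. A \<rightarrow>\<^sub>E ({1,2,3} - {k})"
  let ?X = "{c \<in> colorings A 3. rainbow_sum_free A c}"
  have e: "{1..3} = {1,2,3::nat}" by auto
  have sub: "?W k \<subseteq> ?X" if k: "k \<in> {1,2,3}" for k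
  proof
    fix c assume c: "c \<in> ?W k"
    have val: "c x \<in> {1,2,3} - {k}" if "x \<in> A" for x using c that by (rule PiE_mem)
    have "c \<in> colorings A 3" using c unfolding colorings_def e by (auto simp: PiE_iff)
    moreover have "\<not> rainbow_sum A c x y z" for x y z
    proof
      assume r: "rainbow_sum A c x y z"
      then have "{c x, c y, c z} \<subseteq> {1,2,3} - {k}"
        using val[of x] val[of y] val[of z] by (simp add: rainbow_sum_def)
      then have "card {c x, c y, c z} \<le> card ({1,2,3} - {k})" by (intro card_mono) auto
      moreover have "card ({1,2,3} - {k}) = 2" using k by auto
      moreover have "card {c x, c y, c z} = 3" using r by (simp add: rainbow_sum_def)
      ultimately show False by simp
    qed
    ultimately show "c \<in> ?X" by (simp add: rainbow_sum_free_def)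
  qed
  have fW: "finite (?W k)" for k using fA by (intro finite_PiE) auto
  have fX: "finite ?X" using finite_PiE[OF fA, of "\<lambda>_. {1..3::nat}"] by (simp add: colorings_def)
  have W: "card (?W k) = 2 ^ card A" if "k \<in> {1,2,3}" for k using card_two_colors[OF fA that] .
  have I: "card (?W k \<inter> ?W l) \<le> 1" if "{1,2,3} - {k} - {l} = {j}" for k l j
  proof -
    have "({1,2,3} - {k}) \<inter> ({1,2,3} - {l}) = {1,2,3} - {k} - {l}" by blast
    then have "({1,2,3} - {k}) \<inter> ({1,2,3} - {l}) = {j}" using that by (rule trans)
    then have "?W k \<inter> ?W l = A \<rightarrow>\<^sub>E {j}" by (simp only: PiE_Int)
    then show ?thesis using fA by (simp add: card_PiE)
  qed
  have I12: "card (?W 1 \<inter> ?W 2) \<le> 1" by (rule I[of _ _ 3]) auto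
  have I13: "card (?W 1 \<inter> ?W 3) \<le> 1" by (rule I[of _ _ 2]) auto
  have I23: "card (?W 2 \<inter> ?W 3) \<le> 1" by (rule I[of _ _ 1]) auto
  have "card ((?W 1 \<union> ?W 2) \<inter> ?W 3) \<le> card (?W 1 \<inter> ?W 3) + card (?W 2 \<inter> ?W 3)"
    unfolding Int_Un_distrib2 by (rule card_Un_le)
  moreover have "card (?W 1) + card (?W 2) = card (?W 1 \<union> ?W 2) + card (?W 1 \<inter> ?W 2)"
    using fW by (intro card_Un_Int)
  moreover have "card (?W 1 \<union> ?W 2) + card (?W 3) = card (?W 1 \<union> ?W 2 \<union> ?W 3) + card ((?W 1 \<union> ?W 2) \<inter> ?W 3)"
    using fW by (intro card_Un_Int finite_UnI)
  moreover have "card (?W 1 \<union> ?W 2 \<union> ?W 3) \<le> g A 3"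
    unfolding g_def by (intro card_mono[OF fX] Un_least sub) auto
  ultimately show ?thesis using I12 I13 I23 W[of 1] W[of 2] W[of 3] by simp
qed

theorem mainTheorem3:
  shows "\<exists>n0::nat. \<forall>n>n0.
           (\<forall>A. A \<subseteq> {1..n} \<longrightarrow> (g A 3 = g_max n 3 \<longleftrightarrow> A = {1..n})) \<and>
           (\<forall>A. A \<subset> {1..n} \<longrightarrow> g A 3 < g {1..n} 3)"
proof -
  obtain n0 where n0: "\<And>n A. n \<ge> n0 \<Longrightarrow> 0 \<notin> A \<Longrightarrow> 2 * card (tricol A n) \<le> 2 ^ n"
    using tricol_small by auto
  have less: "g A 3 < g {1..n} 3" if n: "n > max n0 2" and A: "A \<subset> {1..n}" for n A
  proof -
    have "card A < n" using psubset_card_mono[OF _ A] by simp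
    then obtain m where m: "n = Suc m" "card A \<le> m" by (cases n) auto
    \<comment> \<open>With \<open>n = Suc m\<close>, a proper subset gets at most
      \<open>3 * 2 ^ m + 2 ^ m\<close>, while the interval gets at least
      \<open>6 * 2 ^ m - 3\<close>; \<open>2 ^ m \<ge> 4\<close> separates them.\<close>
    have "(2::nat) ^ card A \<le> 2 ^ m" using m by (intro power_increasing) auto
    moreover have "2 * card (tricol A n) \<le> 2 ^ n" using n A by (intro n0) auto
    moreover have "g A 3 \<le> 3 * 2 ^ card A + card (tricol A n)" using A by (intro g_upper) auto
    moreover have "3 * 2 ^ n \<le> g {1..n} 3 + 3" using g_lower[of "{1..n}"] by simp
    moreover have "(4::nat) \<le> 2 ^ m" using n m power_increasing[of 2 m "2::nat"] by simp
    moreover have "(2::nat) ^ n = 2 * 2 ^ m" using m(1) by simp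
    ultimately show ?thesis by linarith
  qed
  have "g A 3 = g_max n 3 \<longleftrightarrow> A = {1..n}" if n: "n > max n0 2" and A: "A \<subseteq> {1..n}" for n A
  proof -
    have "g_max n 3 = g {1..n} 3"
      unfolding g_max_def
    proof (rule Max_eqI)
      fix y assume "y \<in> (\<lambda>A. g A 3) ` Pow {1..n}"
      then obtain B where "B \<subseteq> {1..n}" "y = g B 3" by blast
      then show "y \<le> g {1..n} 3" using less[OF n, of B] by (metis psubsetI less_imp_le order.refl)
    qed auto
    then show ?thesis using less[OF n, of A] A by (metis psubsetI less_irrefl)
  qed
  then show ?thesis using less by blast
qed

end
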